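(* Let $\mathbf{u}$ be the standard sequence over $\{\mathtt a,\mathtt b\}$ whose slope has continued fraction expansion $\theta=[0,1,3,2,2,2,\ldots]$ (all partial quotients from the fourth on equal to $2$), let $\mathbf{y}=(123456)^\omega$ and $\mathbf{y}'=(1'2'3'4'5'6')^\omega$. Then the critical exponent of the balanced sequence $\mathbf{x}_{12}=\mathrm{colour}(\mathbf{u},\mathbf{y},\mathbf{y}')$ (over $12$ letters) equals $\frac{11}{10}$.
   Context: A Sturmian sequence is an aperiodic binary sequence having exactly $n+1$ distinct factors of each length $n$. A standard sequence is a Sturmian sequence $\mathbf{u}$ over $\{\mathtt a,\mathtt b\}$ such that both $\mathtt a\mathbf{u}$ and $\mathtt b\mathbf{u}$ are Sturmian. Convention: the letters are named so that the frequency of $\mathtt b$ exceeds that of $\mathtt a$, and the slope of $\mathbf{u}$ is $\theta=\rho_{\mathtt a}(\mathbf{u})/\rho_{\mathtt b}(\mathbf{u})$ (ratio of letter frequencies); a standard sequence is uniquely determined by its slope. For a binary sequence $\mathbf{u}$ over $\{\mathtt a,\mathtt b\}$ and sequences $\mathbf{y},\mathbf{y}'$ over disjoint alphabets, $\mathrm{colour}(\mathbf{u},\mathbf{y},\mathbf{y}')$ is obtained from $\mathbf{u}$ by replacing the subsequence of all occurrences of $\mathtt a$ by $\mathbf{y}$ and the subsequence of all occurrences of $\mathtt b$ by $\mathbf{y}'$. A sequence is balanced if for any two factors $u,v$ of equal length and any letter $a$, $|u|_a-|v|_a\le 1$. The exponent of a nonempty word $z$ is $|z|/p$ where $p$ is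 the least period of $z$; the critical exponent of a sequence is the supremum of exponents of its nonempty factors. *)

theory Defs
  imports Complex_Main "HOL-Library.Omega_Words_Fun" "HOL-Library.Extended_Real"
begin

datatype letter = La | Lb

definition factor :: "'a word \<Rightarrow> 'a list \<Rightarrow> bool" where
  "factor x w \<longleftrightarrow> (\<exists>i. w = x [i \<rightarrow> i + length w])"

text \<open>Aperiodic means not eventually periodic.\<close>

definition aperiodic :: "'a word \<Rightarrow> bool" where
  "aperiodic x \<longleftrightarrow> \<not> (\<exists>N p. p > 0 \<and> (\<forall>n\<ge>N. x (n + p) = x n))"

definition sturmian :: "letter word \<Rightarrow> bool" where
  "sturmian u \<longleftrightarrow>
     aperiodic u \<and> (\<forall>n. card {w. factor u w \<and> length w = n} = n + 1)"

definition standard :: "letter word \<Rightarrow> bool" where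
  "standard u \<longleftrightarrow> sturmian u \<and> sturmian ([La] \<frown> u) \<and> sturmian ([Lb] \<frown> u)"

definition has_frequency :: "'a word \<Rightarrow> 'a \<Rightarrow> real \<Rightarrow> bool" where
  "has_frequency x c r \<longleftrightarrow> (\<lambda>n. real (count_list (prefix n x) c) / real n) \<longlonglongrightarrow> r"

text \<open>The slope is only used for sequences whose letters are named so that
  \<open>Lb\<close> is the more frequent one.\<close>

definition has_slope :: "letter word \<Rightarrow> real \<Rightarrow> bool" where
  "has_slope u \<theta> \<longleftrightarrow>
     (\<exists>r s. has_frequency u La r \<and> has_frequency u Lb s \<and> r < s \<and> \<theta> = r / s)"

text \<open>The convergent \<open>[a 0, a 1, \<dots>, a n]\<close> of a continued fraction.\<close>

fun convergent_cf :: "(nat \<Rightarrow> int) \<Rightarrow> nat \<Rightarrow> real" where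
  "convergent_cf a 0 = of_int (a 0)"
| "convergent_cf a (Suc n) = of_int (a 0) + 1 / convergent_cf (\<lambda>k. a (Suc k)) n"

definition has_cf_expansion :: "real \<Rightarrow> (nat \<Rightarrow> int) \<Rightarrow> bool" where
  "has_cf_expansion \<theta> a \<longleftrightarrow> (\<forall>k\<ge>1. a k \<ge> 1) \<and> convergent_cf a \<longlonglongrightarrow> \<theta>"

text \<open>The sum type makes the alphabets of the two colouring sequences disjoint.
  Position \<open>n\<close> receives the entry of \<open>y\<close> (or \<open>y'\<close>) whose index is the number of
  earlier occurrences of the letter \<open>u n\<close>.\<close>

definition colour :: "letter word \<Rightarrow> 'b word \<Rightarrow> 'c word \<Rightarrow> ('b + 'c) word" where
  "colour u y y' = (\<lambda>n. case u n of
       La \<Rightarrow> Inl (y (count_list (prefix n u) La))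
     | Lb \<Rightarrow> Inr (y' (count_list (prefix n u) Lb)))"

definition balanced :: "'a word \<Rightarrow> bool" where
  "balanced x \<longleftrightarrow> (\<forall>v w c. factor x v \<and> factor x w \<and> length v = length w
      \<longrightarrow> int (count_list v c) - int (count_list w c) \<le> 1)"

definition is_period :: "'a list \<Rightarrow> nat \<Rightarrow> bool" where
  "is_period z p \<longleftrightarrow> p > 0 \<and> (\<forall>i. i + p < length z \<longrightarrow> z ! (i + p) = z ! i)"

definition least_period :: "'a list \<Rightarrow> nat" where
  "least_period z = (LEAST p. is_period z p)"

definition exponent :: "'a list \<Rightarrow> real" where
  "exponent z = real (length z) / real (least_period z)"

text \<open>The supremum may be infinite, so it is taken in the extended reals.\<close>

definition critical_exponent :: "'a word \<Rightarrow> ereal" where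
  "critical_exponent x = (SUP z \<in> {z. z \<noteq> [] \<and> factor x z}. ereal (exponent z))"

end

theory Submission
  imports Defs
begin

text \<open>
  Let \<open>\<alpha>\<close> be the frequency of \<open>La\<close>. A Sturmian sequence is balanced, and in a standard one every
  prefix of length \<open>n\<close> can be preceded by either letter, so all factors of length \<open>n + 1\<close> contain
  as many or one more letters \<open>La\<close> than the prefix of length \<open>n\<close>. Hence that prefix contains
  exactly \<open>\<lfloor>(n + 1) \<alpha>\<rfloor>\<close> letters \<open>La\<close>, where the slope gives \<open>\<alpha> = (6 + \<surd>2) / 17\<close>.

  Suppose that a factor of length \<open>m\<close> of the coloured sequence reoccurs at distance \<open>p\<close>. If it
  involves both letters, then \<open>p = 6 p'\<close> and the passage from one occurrence to the other contains
  \<open>6 P'\<close> letters \<open>La\<close>; the equality of the two occurrences says that \<open>m + 1\<close> consecutive points of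
  the rotation by \<open>\<alpha>\<close> avoid an interval of length \<open>6 \<bar>p' \<alpha> - P'\<bar>\<close>. Best approximation bounds this
  length from below by six times the error of a convergent of \<open>\<alpha>\<close>, and an interval that is at
  least as long as the sum of two opposite steps \<open>q \<alpha> - r\<close> and \<open>q' \<alpha> - r'\<close> is visited in every
  window of \<open>max q q'\<close> consecutive times. Taking for \<open>q\<close> the difference of two consecutive
  denominators and for \<open>q'\<close> the smaller one gives \<open>10 m \<le> p\<close>. Repetitions with one letter only are
  shorter than three and are treated directly; one with \<open>m = 1\<close> and \<open>p = 10\<close> attains the bound.
\<close>

section \<open>Sturmian sequences are balanced\<close>

lemma factor_iff_nth:
  "factor x w \<longleftrightarrow> (\<exists>i. \<forall>k<length w. w ! k = x (i + k))"
  unfolding factor_def list_eq_iff_nth_eq by simp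

lemma factor_subsequence: "factor x (x [i \<rightarrow> i + n])"
  unfolding factor_iff_nth by auto

lemma subsequence_Suc_right: "x [i \<rightarrow> Suc (i + n)] = x [i \<rightarrow> i + n] @ [x (i + n)]"
  by (simp add: subsequence_def)

lemma subsequence_eq_iff:
  "x [i \<rightarrow> i + n] = y [j \<rightarrow> j + n] \<longleftrightarrow> (\<forall>k<n. x (i + k) = y (j + k))"
  by (auto simp: list_eq_iff_nth_eq)

definition right_special :: "letter word \<Rightarrow> letter list \<Rightarrow> bool" where
  "right_special u r \<longleftrightarrow> factor u (r @ [La]) \<and> factor u (r @ [Lb])"

lemma factor_butlast: "factor u (r @ [c]) \<Longrightarrow> factor u r"
  unfolding factor_iff_nth by (force simp: nth_append less_Suc_eq)

lemma factor_extend: "factor u r \<Longrightarrow> factor u (r @ [La]) \<or> factor u (r @ [Lb])"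
proof -
  assume "factor u r"
  then obtain i where "r = u [i \<rightarrow> i + length r]" unfolding factor_def by blast
  then have "factor u (r @ [u (i + length r)])"
    by (metis add_Suc_right factor_subsequence subsequence_Suc_right)
  then show ?thesis by (cases "u (i + length r)") auto
qed

text \<open>Deleting the last letter maps the factors of length \<open>n + 1\<close> onto those of
  length \<open>n\<close>, and exactly the right special ones have two preimages. Since the number
  of factors grows by one, there is one such factor per length.\<close>

lemma right_special_unique:
  assumes "sturmian u"
  shows "\<exists>r. {r. right_special u r \<and> length r = n} = {r}"
proof -
  define F where "F n = {w. factor u w \<and> length w = n}" for n
  define E where "E c = {r. factor u (r @ [c]) \<and> length r = n}" for c
  have cF: "card (F n) = n + 1" for n
    using assms by (simp add: sturmian_def F_def)
  then have finF: "finite (F n)" for n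
    by (metis Suc_eq_plus1 card.infinite nat.distinct(1))
  have union: "E La \<union> E Lb = F n"
    unfolding E_def F_def by (auto dest: factor_butlast factor_extend)
  then have fin: "finite (E c)" for c
    using finF[of n] by (cases c) (metis finite_Un)+
  have *: "F (Suc n) = (\<lambda>r. r @ [La]) ` E La \<union> (\<lambda>r. r @ [Lb]) ` E Lb"
  proof -
    have "w \<in> (\<lambda>r. r @ [La]) ` E La \<union> (\<lambda>r. r @ [Lb]) ` E Lb" if "w \<in> F (Suc n)" for w
    proof -
      from that obtain r c where "w = r @ [c]" "length r = n"
        by (metis (mono_tags, lifting) F_def length_Suc_conv_rev mem_Collect_eq)
      with that show ?thesis by (cases c) (auto simp: E_def F_def)
    qed
    then show ?thesis by (auto simp: E_def F_def)
  qed
  have "card (F (Suc n)) = card (E La) + card (E Lb)"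
    unfolding * by (subst card_Un_disjoint) (auto simp: fin card_image inj_on_def)
  also have "\<dots> = card (F n) + card (E La \<inter> E Lb)"
    using card_Un_Int[OF fin fin] union by metis
  finally have "card (E La \<inter> E Lb) = 1" by (simp add: cF)
  moreover have "E La \<inter> E Lb = {r. right_special u r \<and> length r = n}"
    by (auto simp: E_def right_special_def)
  ultimately show ?thesis by (metis card_1_singletonE)
qed

definition La_count :: "letter word \<Rightarrow> nat \<Rightarrow> int" where
  "La_count u n = int (count_list (prefix n u) La)"

lemma La_count_0 [simp]: "La_count u 0 = 0"
  by (simp add: La_count_def)

lemma La_count_Suc: "La_count u (Suc n) = La_count u n + (if u n = La then 1 else 0)"
  by (simp add: La_count_def subsequence_def)

lemma count_Lb: "int (count_list (prefix n u) Lb) = int n - La_count u n"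
proof (induction n)
  case (Suc n)
  then show ?case
    by (cases "u n") (simp_all add: La_count_def subsequence_def)
qed (simp add: La_count_def)

lemma letter_eqI: "(c = La \<longleftrightarrow> d = La) \<Longrightarrow> c = d"
  by (cases c; cases d; simp)

lemma letter_neq: "c \<noteq> La \<longleftrightarrow> c = Lb" "c \<noteq> Lb \<longleftrightarrow> c = La"
  by (cases c; simp)+

definition La_balanced :: "letter word \<Rightarrow> bool" where
  "La_balanced u \<longleftrightarrow> (\<forall>i j n. La_count u (i + n) - La_count u i
     \<le> La_count u (j + n) - La_count u j + 1)"

text \<open>Take a shortest pair of equally long windows whose counts of \<open>La\<close> differ by
  more than one. That all shorter pairs differ by at most one forces the stated shape.\<close>

lemma unbalanced_palindrome:
  assumes "\<not> La_balanced u"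
  obtains i j n where "u i = La" "u j = Lb" "u (i + Suc n) = La" "u (j + Suc n) = Lb"
    "\<And>k. 1 \<le> k \<Longrightarrow> k \<le> n \<Longrightarrow> u (i + k) = u (j + k)"
    "\<And>k. 1 \<le> k \<Longrightarrow> k \<le> n \<Longrightarrow> u (i + k) = u (i + (Suc n - k))"
proof -
  define S where "S = La_count u"
  have step: "S (Suc k) = S k + (if u k = La then 1 else 0)" for k
    by (simp add: S_def La_count_Suc)
  define P where "P n \<longleftrightarrow> (\<exists>i j. S (i + n) - S i > S (j + n) - S j + 1)" for n
  have "\<exists>n. P n"
    using assms unfolding La_balanced_def P_def S_def by (metis linorder_not_le)
  then obtain N where N: "P N" "\<And>n. n < N \<Longrightarrow> \<not> P n"
    by (metis exists_least_iff)
  from N(1) obtain i j where ij: "S (i + N) - S i > S (j + N) - S j + 1"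
    unfolding P_def by auto
  have min: "S (i' + n) - S i' \<le> S (j' + n) - S j' + 1" if "n < N" for i' j' n
    using N(2)[OF that] unfolding P_def by (metis linorder_not_le)
  have N2: "2 \<le> N"
  proof (rule ccontr)
    assume "\<not> 2 \<le> N"
    then have "N = 0 \<or> N = 1" by auto
    then show False using ij step[of i] step[of j] by (auto split: if_splits)
  qed
  \<comment> \<open>Minimality leaves \<open>g\<close> no choice but to rise from 0 to 1 at the first letter, to stay there,
    and to rise to 2 at the last one: the two windows are \<open>La w La\<close> and \<open>Lb w Lb\<close>.\<close>
  define g where "g k = (S (i + k) - S i) - (S (j + k) - S j)" for k
  have g1: "g k = 1" if "1 \<le> k" "k < N" for k
  proof -
    have "g k \<le> 1" using min[OF that(2), of i j] by (simp add: g_def)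
    moreover have "g N - g k \<le> 1"
      using min[of "N - k" "i + k" "j + k"] that by (simp add: g_def)
    ultimately show ?thesis using ij by (simp add: g_def)
  qed
  have g0: "g 0 = 0" by (simp add: g_def)
  have gN: "g N = 2"
  proof -
    have "g N - g 1 \<le> 1"
      using min[of "N - 1" "i + 1" "j + 1"] N2 by (simp add: g_def)
    then show ?thesis using g1[of 1] N2 ij by (simp add: g_def)
  qed
  have gstep: "g (Suc k) = g k + (if u (i + k) = La then 1 else 0) - (if u (j + k) = La then 1 else 0)" for k
    using step[of "i + k"] step[of "j + k"] by (simp add: g_def)
  \<comment> \<open>Comparing prefixes of the first window with suffixes of the second shows in the same way
    that \<open>w\<close> is a palindrome.\<close>
  define h where "h k = (S (i + k) - S i) - (S (j + N) - S (j + (N - k)))" for k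
  have h1: "h k = 1" if "1 \<le> k" "k < N" for k
  proof -
    have "h k \<le> 1" using min[OF that(2), of i "j + (N - k)"] that by (simp add: h_def)
    moreover have "(S (i + N) - S (i + (N - k))) - (S (j + k) - S j) \<le> 1"
      using min[OF that(2), of "i + (N - k)" j] that by simp
    moreover have "h k + ((S (i + N) - S (i + (N - k))) - (S (j + k) - S j)) = g k + (g N - g (N - k))"
      by (simp add: h_def g_def)
    moreover have "g (N - k) = 1" using g1[of "N - k"] that by simp
    ultimately show ?thesis using g1[OF that] gN by simp
  qed
  obtain n where n: "N = Suc (Suc n)" using N2 by (metis Suc_le_D numeral_2_eq_2 Suc_le_mono)
  have eq: "u (i + k) = u (j + k)" if "1 \<le> k" "k \<le> n" for k
    using gstep[of k] g1[of k] g1[of "Suc k"] that n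
    by (intro letter_eqI) (simp split: if_splits)
  show ?thesis
  proof (rule that[of i j n])
    show "u i = La" "u j = Lb"
      using gstep[of 0] g0 g1[of 1] n by (auto simp: letter_neq split: if_splits)
    show "u (i + Suc n) = La" "u (j + Suc n) = Lb"
      using gstep[of "Suc n"] gN g1[of "Suc n"] n by (auto simp: letter_neq split: if_splits)
    show "u (i + k) = u (j + k)" if "1 \<le> k" "k \<le> n" for k using eq that by blast
    show "u (i + k) = u (i + (Suc n - k))" if "1 \<le> k" "k \<le> n" for k
    proof -
      have "h (Suc k) = h k" using h1[of k] h1[of "Suc k"] that n by simp
      moreover have "S (j + (N - k)) = S (j + (Suc n - k)) + (if u (j + (Suc n - k)) = La then 1 else 0)"
        using step[of "j + (Suc n - k)"] that n by (simp add: Suc_diff_le)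
      moreover have "N - Suc k = Suc n - k" using n by simp
      ultimately have "(if u (i + k) = La then 1 else 0) = (if u (j + (Suc n - k)) = La then 1 else (0::int))"
        using step[of "i + k"] unfolding h_def by simp
      then have "u (i + k) = u (j + (Suc n - k))"
        by (intro letter_eqI) (simp split: if_splits)
      then show ?thesis using eq[of "Suc n - k"] that by simp
    qed
  qed
qed

lemma nonspecial_next:
  assumes "\<not> right_special u (u [i \<rightarrow> i + n])" "u [i \<rightarrow> i + n] = u [j \<rightarrow> j + n]"
  shows "u (i + n) = u (j + n)"
proof (rule ccontr)
  assume neq: "u (i + n) \<noteq> u (j + n)"
  have *: "factor u (u [i \<rightarrow> i + n] @ [u (i + n)])" "factor u (u [i \<rightarrow> i + n] @ [u (j + n)])"
    using factor_subsequence[of u i "Suc n"] factor_subsequence[of u j "Suc n"] assms(2)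
    by (simp_all add: subsequence_Suc_right)
  have "{u (i + n), u (j + n)} = {La, Lb}"
    using neq by (cases "u (i + n)"; cases "u (j + n)") auto
  with * have "right_special u (u [i \<rightarrow> i + n])"
    unfolding right_special_def doubleton_eq_iff by auto
  with assms(1) show False by simp
qed

text \<open>An imbalance would produce a stretch that misses the only right special factor of its
  length; missing it for long enough makes \<open>u\<close> eventually periodic.\<close>

lemma sturmian_La_balanced:
  assumes "sturmian u"
  shows "La_balanced u"
proof (rule ccontr)
  assume "\<not> La_balanced u"
  then obtain i j n where ij: "u i = La" "u j = Lb" "u (i + Suc n) = La" "u (j + Suc n) = Lb"
    and eq: "\<And>k. 1 \<le> k \<Longrightarrow> k \<le> n \<Longrightarrow> u (i + k) = u (j + k)"
    and pal: "\<And>k. 1 \<le> k \<Longrightarrow> k \<le> n \<Longrightarrow> u (i + k) = u (i + (Suc n - k))"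
    using unbalanced_palindrome by blast
  define w where "w = u [Suc i \<rightarrow> Suc i + n]"
  have wj: "w = u [Suc j \<rightarrow> Suc j + n]"
    unfolding w_def subsequence_eq_iff using eq by (metis Suc_leI add_Suc_shift le_add1 plus_1_eq_Suc)
  have w_special: "right_special u w"
    using factor_subsequence[of u "Suc i" "Suc n"] factor_subsequence[of u "Suc j" "Suc n"] ij w_def wj
    by (simp add: right_special_def)
  \<comment> \<open>Suffixes of right special factors are right special, so by uniqueness the
    special factor of length \<open>Suc n\<close> ends in \<open>w\<close>.\<close>
  have sp: "r = c # w" if "right_special u r" "length r = Suc n" "r = c # r'" for r c r'
  proof -
    have f: "factor u (r' @ [d])" if "factor u ((c # r') @ [d])" for d
    proof -
      from that obtain k where k: "\<forall>l<length ((c # r') @ [d]). ((c # r') @ [d]) ! l = u (k + l)"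
        unfolding factor_iff_nth by auto
      have "\<forall>l<length (r' @ [d]). (r' @ [d]) ! l = u (Suc k + l)"
        using k[rule_format, of "Suc _"] by simp
      then show ?thesis unfolding factor_iff_nth by blast
    qed
    have "right_special u r'" using that f by (simp add: right_special_def)
    then have "r' \<in> {r. right_special u r \<and> length r = n}" "w \<in> {r. right_special u r \<and> length r = n}"
      using that w_special by (simp_all add: w_def)
    then have "r' = w" using right_special_unique[OF assms, of n] by (metis singletonD)
    then show ?thesis using that by simp
  qed
  obtain s where s: "{r. right_special u r \<and> length r = Suc n} = {s}"
    using right_special_unique[OF assms] by blast
  then have s_special: "right_special u s" "length s = Suc n" by auto
  have word_at: "u [k \<rightarrow> k + Suc n] = u k # u [Suc k \<rightarrow> Suc k + n]" for k
    by (simp add: subsequence_def upt_conv_Cons del: upt_Suc)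
  obtain c where c: "s = c # w"
    using sp[OF s_special] s_special(2) by (cases s) auto
  \<comment> \<open>With \<open>d\<close> the other letter, \<open>d w d\<close> occurs at \<open>t\<close>. The special word \<open>s = c w\<close> occurs at none
    of the \<open>n + 2\<close> positions from \<open>t\<close> on, so two of the factors of length \<open>n + 1\<close> there agree; as
    long as \<open>s\<close> is avoided, each factor determines the next, which makes \<open>u\<close> eventually periodic.\<close>
  obtain t where t: "u t \<noteq> c" "u (t + Suc n) \<noteq> c"
      "\<And>k. 1 \<le> k \<Longrightarrow> k \<le> n \<Longrightarrow> u (t + k) = u (t + (Suc n - k))"
      "\<And>k. 1 \<le> k \<Longrightarrow> k \<le> n \<Longrightarrow> u (t + k) = u (i + k)"
  proof (cases c)
    case La
    show ?thesis
    proof (rule that[of j])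
      show "u (j + k) = u (j + (Suc n - k))" if "1 \<le> k" "k \<le> n" for k
        using eq[of k] eq[of "Suc n - k"] pal[of k] that by auto
    qed (use ij eq La in auto)
  next
    case Lb
    show ?thesis using that[of i] ij pal Lb by auto
  qed
  define f where "f k = u [k \<rightarrow> k + Suc n]" for k
  have f_ne: "f (t + k) \<noteq> s" if k: "k \<le> Suc n" for k
  proof
    assume "f (t + k) = s"
    then have *: "u (t + k) = c" "u [Suc (t + k) \<rightarrow> Suc (t + k) + n] = w"
      using word_at[of "t + k"] c by (auto simp: f_def)
    consider "k = 0" | "k = Suc n" | "1 \<le> k" "k \<le> n" using k by linarith
    then show False
    proof cases
      \<comment> \<open>The copy of \<open>w\<close> that starts after position \<open>t + k\<close>
        covers position \<open>t + Suc n\<close>. The palindrome property identifies the letter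
        there with \<open>u (t + k) = c\<close>, but \<open>u (t + Suc n)\<close> differs from
        \<open>c\<close>.\<close>
      case 3
      have "u (Suc (t + k) + (n - k)) = u (Suc i + (n - k))"
        using *(2)[unfolded w_def subsequence_eq_iff, rule_format, of "n - k"] 3 by simp
      moreover have "Suc (t + k) + (n - k) = t + Suc n" "Suc i + (n - k) = i + (Suc n - k)"
        using 3 by auto
      moreover have "u (i + (Suc n - k)) = u (t + k)"
        using pal[of k] t(4)[of k] 3 by simp
      ultimately show False using *(1) t(2) by metis
    qed (use * t in auto)
  qed
  have nonspecial: "\<not> right_special u (f k)" if "f k \<noteq> s" for k
  proof
    assume "right_special u (f k)"
    then have "f k \<in> {r. right_special u r \<and> length r = Suc n}" by (simp add: f_def)
    then show False using that unfolding s by simp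
  qed
  have "\<not> inj_on (\<lambda>k. f (t + k)) {..Suc n}"
  proof
    assume inj: "inj_on (\<lambda>k. f (t + k)) {..Suc n}"
    let ?F = "{w. factor u w \<and> length w = Suc n}"
    have cF: "card ?F = Suc n + 1"
      using assms unfolding sturmian_def by blast
    then have fin: "finite ?F" by (metis Suc_eq_plus1 card.infinite nat.distinct(1))
    have "(\<lambda>k. f (t + k)) ` {..Suc n} \<subseteq> ?F - {s}"
    proof (rule image_subsetI)
      fix k assume "k \<in> {..Suc n}"
      then have "f (t + k) \<noteq> s" using f_ne by simp
      moreover have "factor u (f (t + k))" unfolding f_def by (rule factor_subsequence)
      ultimately show "f (t + k) \<in> ?F - {s}" by (simp add: f_def)
    qed
    then have "card {..Suc n} \<le> card (?F - {s})"
      using fin by (intro card_inj_on_le[OF inj]) simp_all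
    moreover have "s \<in> ?F"
      using s_special by (auto simp: right_special_def dest: factor_butlast)
    ultimately show False using cF fin by simp
  qed
  then obtain a b where ab: "a < b" "b \<le> Suc n" "f (t + a) = f (t + b)"
    unfolding inj_on_def by (metis atMost_iff linorder_neqE_nat)
  have per: "f (t + a + l) = f (t + b + l) \<and> f (t + a + l) \<noteq> s" for l
  proof (induction l rule: less_induct)
    case (less l)
    have e: "f (t + a + l) = f (t + b + l)"
    proof (cases l)
      case 0
      then show ?thesis using ab by simp
    next
      case (Suc l')
      then have eq': "f (t + a + l') = f (t + b + l')" and ns: "\<not> right_special u (f (t + a + l'))"
        using less[of l'] nonspecial[of "t + a + l'"] by auto
      have "u (t + a + l' + Suc n) = u (t + b + l' + Suc n)"
        using nonspecial_next ns eq' unfolding f_def by blast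
      moreover have "u (t + a + l' + k) = u (t + b + l' + k)" if "k < Suc n" for k
        using eq' that unfolding f_def subsequence_eq_iff by blast
      ultimately have "u (t + a + l' + k) = u (t + b + l' + k)" if "k < Suc (Suc n)" for k
        using that by (metis less_Suc_eq)
      from this[of "Suc _"] show ?thesis
        unfolding f_def subsequence_eq_iff Suc by simp
    qed
    moreover have "f (t + a + l) \<noteq> s"
    proof (cases "a + l \<le> Suc n")
      case True
      then show ?thesis using f_ne[of "a + l"] by (simp add: add.assoc)
    next
      case False
      \<comment> \<open>Beyond the first \<open>n + 2\<close> positions, avoidance of
        \<open>s\<close> is inherited from one period \<open>b - a\<close> earlier.\<close>
      define l' where "l' = l - (b - a)"
      have "t + a + l = t + b + l'" "l' < l" using False ab by (auto simp: l'_def)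
      then show ?thesis using less[of l'] by metis
    qed
    ultimately show ?case by simp
  qed
  have "u (m + (b - a)) = u m" if m: "t + a \<le> m" for m
  proof -
    obtain l where l: "m = t + a + l" using le_Suc_ex[OF m] by blast
    moreover have "t + b + l = m + (b - a)" using ab l by simp
    ultimately have "f m = f (m + (b - a))" using per[of l] by metis
    then show ?thesis unfolding f_def word_at by (metis list.inject)
  qed
  moreover have "b - a > 0" using ab by simp
  ultimately have "\<not> aperiodic u" unfolding aperiodic_def by blast
  then show False using assms by (simp add: sturmian_def)
qed

section \<open>Prefix counts of a standard sequence\<close>

lemma La_count_diff:
  "int (count_list (u [i \<rightarrow> i + n]) La) = La_count u (i + n) - La_count u i"
  by (induction n) (simp_all add: La_count_def)

text \<open>Both \<open>La # prefix n u\<close> and \<open>Lb # prefix n u\<close> occur in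
  \<open>u\<close>. Their counts differ by one, so balance leaves no room for any other
  value.\<close>

lemma standard_window:
  assumes "standard u"
  shows "La_count u n \<le> La_count u (k + Suc n) - La_count u k"
    and "La_count u (k + Suc n) - La_count u k \<le> La_count u n + 1"
proof -
  have ext: "\<exists>i. u [i \<rightarrow> i + Suc n] = c # prefix n u" for c
  proof -
    have "sturmian u" "sturmian ([c] \<frown> u)"
      using assms by (cases c; simp add: standard_def)+
    then have card: "card {w. factor u w \<and> length w = Suc n} = Suc n + 1"
      "card {w. factor ([c] \<frown> u) w \<and> length w = Suc n} = Suc n + 1"
      unfolding sturmian_def by blast+
    have sub: "factor ([c] \<frown> u) w" if "factor u w" for w
    proof -
      from that obtain i where i: "\<forall>k<length w. w ! k = u (i + k)"
        unfolding factor_iff_nth by blast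
      have "\<forall>k<length w. w ! k = ([c] \<frown> u) (Suc i + k)"
        using i by (simp add: conc_def)
      then show ?thesis unfolding factor_iff_nth by blast
    qed
    have "finite {w. factor ([c] \<frown> u) w \<and> length w = Suc n}"
      using card(2) by (metis Suc_eq_plus1 card.infinite nat.distinct(1))
    \<comment> \<open>Prepending a letter can only add factors, but both sets have
      \<open>n + 2\<close> elements, so they coincide.\<close>
    then have eq: "{w. factor u w \<and> length w = Suc n} = {w. factor ([c] \<frown> u) w \<and> length w = Suc n}"
      using card sub by (intro card_subset_eq) auto
    have "\<forall>k<length (c # prefix n u). (c # prefix n u) ! k = ([c] \<frown> u) (0 + k)"
      by (auto simp: conc_def nth_Cons split: nat.splits)
    then have "factor ([c] \<frown> u) (c # prefix n u)"
      unfolding factor_iff_nth by blast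
    then have "c # prefix n u \<in> {w. factor u w \<and> length w = Suc n}" unfolding eq by simp
    then obtain i where "c # prefix n u = u [i \<rightarrow> i + length (c # prefix n u)]"
      unfolding factor_def by blast
    moreover have "length (c # prefix n u) = Suc n" by simp
    ultimately show ?thesis by metis
  qed
  have bal: "La_balanced u"
    using assms sturmian_La_balanced by (simp add: standard_def)
  obtain i j where "u [i \<rightarrow> i + Suc n] = La # prefix n u" "u [j \<rightarrow> j + Suc n] = Lb # prefix n u"
    using ext by blast
  then have "La_count u (i + Suc n) - La_count u i = La_count u n + 1"
    "La_count u (j + Suc n) - La_count u j = La_count u n"
    using La_count_diff[of u i "Suc n"] La_count_diff[of u j "Suc n"]
    by (simp_all add: La_count_def del: subseq_to_Suc add_Suc_right)
  then show "La_count u n \<le> La_count u (k + Suc n) - La_count u k"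
    "La_count u (k + Suc n) - La_count u k \<le> La_count u n + 1"
    using bal[unfolded La_balanced_def, rule_format, of i "Suc n" k]
      bal[unfolded La_balanced_def, rule_format, of k "Suc n" j] by linarith+
qed

text \<open>Cut the prefix of length \<open>m * Suc n\<close> into \<open>m\<close> windows, apply
  \<open>standard_window\<close> to each, divide by the length and let \<open>m\<close> tend to
  infinity.\<close>

lemma standard_La_count_le:
  assumes "standard u" "has_frequency u La r"
  shows "of_int (La_count u n) \<le> (real n + 1) * r"
    and "(real n + 1) * r \<le> of_int (La_count u n) + 1"
proof -
  have S: "int m * La_count u n \<le> La_count u (m * Suc n)
      \<and> La_count u (m * Suc n) \<le> int m * (La_count u n + 1)" for m
  proof (induction m)
    case (Suc m)
    have e: "Suc m * Suc n = m * Suc n + Suc n" by simp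
    show ?case
      using standard_window[OF assms(1), of n "m * Suc n"] Suc
      unfolding e by (simp add: algebra_simps)
  qed simp
  have "(\<lambda>k. real_of_int (La_count u k) / real k) \<longlonglongrightarrow> r"
    using assms(2) by (simp add: has_frequency_def La_count_def)
  moreover have "strict_mono (\<lambda>m. Suc m * Suc n)"
    by (intro strict_monoI) (simp add: add_less_le_mono)
  ultimately have lim: "(\<lambda>m. real_of_int (La_count u (Suc m * Suc n)) / real (Suc m * Suc n)) \<longlonglongrightarrow> r"
    by (drule_tac LIMSEQ_subseq_LIMSEQ) (auto simp: o_def)
  have b: "real_of_int (La_count u n) / (real n + 1)
        \<le> real_of_int (La_count u (Suc m * Suc n)) / real (Suc m * Suc n)
      \<and> real_of_int (La_count u (Suc m * Suc n)) / real (Suc m * Suc n)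
        \<le> (real_of_int (La_count u n) + 1) / (real n + 1)" for m
  proof -
    define M N where "M = real (Suc m)" and "N = real n + 1"
    have pos: "M > 0" "N > 0" by (auto simp: M_def N_def)
    have MN: "real (Suc m * Suc n) = M * N" by (simp add: M_def N_def algebra_simps)
    have "real_of_int (int (Suc m) * La_count u n) \<le> real_of_int (La_count u (Suc m * Suc n))"
      "real_of_int (La_count u (Suc m * Suc n)) \<le> real_of_int (int (Suc m) * (La_count u n + 1))"
      using S[of "Suc m"] by (simp_all only: of_int_le_iff)
    then have "M * of_int (La_count u n) \<le> real_of_int (La_count u (Suc m * Suc n))"
      "real_of_int (La_count u (Suc m * Suc n)) \<le> M * (of_int (La_count u n) + 1)"
      by (simp_all add: M_def)
    then show ?thesis unfolding MN N_def[symmetric] using pos by (simp add: field_simps)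
  qed
  have "real_of_int (La_count u n) / (real n + 1) \<le> r"
    by (rule LIMSEQ_le_const[OF lim]) (use b in blast)
  then show "of_int (La_count u n) \<le> (real n + 1) * r"
    by (simp add: field_simps)
  have "r \<le> (real_of_int (La_count u n) + 1) / (real n + 1)"
    by (rule LIMSEQ_le_const2[OF lim]) (use b in blast)
  then show "(real n + 1) * r \<le> of_int (La_count u n) + 1"
    by (simp add: field_simps)
qed

lemma frequencies_sum:
  assumes "has_frequency u La r" "has_frequency u Lb s"
  shows "r + s = 1"
proof -
  have "(\<lambda>n. real (count_list (prefix n u) La) / real n + real (count_list (prefix n u) Lb) / real n)
      \<longlonglongrightarrow> r + s"
    using assms unfolding has_frequency_def by (rule tendsto_add)
  moreover have "\<forall>\<^sub>F n in sequentially. real (count_list (prefix n u) La) / real n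
      + real (count_list (prefix n u) Lb) / real n = 1"
  proof (rule eventually_sequentiallyI[of 1])
    fix n :: nat assume "1 \<le> n"
    have "int (count_list (prefix n u) La) + int (count_list (prefix n u) Lb) = int n"
      using count_Lb[of u n] by (simp add: La_count_def)
    then have "real (count_list (prefix n u) La) + real (count_list (prefix n u) Lb) = real n"
      by linarith
    then show "real (count_list (prefix n u) La) / real n
      + real (count_list (prefix n u) Lb) / real n = 1"
      using \<open>1 \<le> n\<close> by (simp add: add_divide_distrib[symmetric])
  qed
  ultimately show ?thesis
    by (blast intro: LIMSEQ_unique tendsto_eventually)
qed

section \<open>Numerical values of the slope and of the letter frequency\<close>

text \<open>The map \<open>c \<mapsto> 2 + 1 / c\<close> fixes \<open>1 + sqrt 2\<close> and shrinks
  distances at least fourfold on numbers that are at least 2.\<close>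

lemma convergents_const_2: "convergent_cf (\<lambda>_. 2) \<longlonglongrightarrow> 1 + sqrt 2"
proof -
  let ?c = "convergent_cf (\<lambda>_. 2)"
  define l where "l = 1 + sqrt 2"
  have l: "l \<ge> 2" "l = 2 + 1 / l"
  proof -
    have "sqrt 2 \<ge> 1" by simp
    then show "l \<ge> 2" by (simp add: l_def)
    have "l * l = 2 * l + 1" by (simp add: l_def algebra_simps)
    then show "l = 2 + 1 / l" using \<open>l \<ge> 2\<close> by (simp add: field_simps)
  qed
  have c2: "?c n \<ge> 2" for n
  proof (induction n)
    case (Suc n)
    then have "1 / ?c n \<ge> 0" by simp
    then show ?case by simp
  qed simp
  have "\<bar>?c n - l\<bar> \<le> (1/4) ^ n * \<bar>2 - l\<bar>" for n
  proof (induction n)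
    case (Suc n)
    have pos: "?c n > 0" "l > 0" using c2[of n] l by linarith+
    have "?c (Suc n) - l = 1 / ?c n - 1 / l" using l(2) by simp
    also have "\<dots> = (l - ?c n) / (?c n * l)" using pos by (simp add: field_simps)
    finally have "\<bar>?c (Suc n) - l\<bar> = \<bar>?c n - l\<bar> / (?c n * l)"
      using pos by (simp add: abs_mult abs_minus_commute)
    also have "2 * 2 \<le> ?c n * l" using c2[of n] l(1) by (intro mult_mono) auto
    then have "\<bar>?c n - l\<bar> / (?c n * l) \<le> \<bar>?c n - l\<bar> / 4"
      using pos by (intro divide_left_mono) auto
    also have "\<dots> \<le> (1/4) ^ Suc n * \<bar>2 - l\<bar>" using Suc by simp
    finally show ?case .
  qed simp
  moreover have "(\<lambda>n. (1/4) ^ n * \<bar>2 - l\<bar>) \<longlonglongrightarrow> 0"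
    by (intro tendsto_mult_left_zero LIMSEQ_realpow_zero) auto
  ultimately have "(\<lambda>n. \<bar>?c n - l\<bar>) \<longlonglongrightarrow> 0"
    by (intro tendsto_sandwich[of "\<lambda>_. 0" "\<lambda>n. \<bar>?c n - l\<bar>" _ "\<lambda>n. (1/4) ^ n * \<bar>2 - l\<bar>"]) auto
  then have "(\<lambda>n. ?c n - l) \<longlonglongrightarrow> 0"
    by (rule tendsto_rabs_zero_cancel)
  then show ?thesis unfolding l_def using LIM_zero_cancel by blast
qed

lemma slope_value:
  assumes "has_cf_expansion \<theta> ([0, 1, 3] \<frown> [2]\<^sup>\<omega>)"
  shows "\<theta> = (2 + sqrt 2) / (3 + sqrt 2)"
proof -
  define a :: "nat \<Rightarrow> int" where "a = [0, 1, 3] \<frown> [2]\<^sup>\<omega>"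
  have a: "a 0 = 0" "a (Suc 0) = 1" "a (Suc (Suc 0)) = 3" "(\<lambda>k. a (Suc (Suc (Suc k)))) = (\<lambda>_. 2)"
    by (auto simp: a_def conc_def)
  have "convergent_cf a (n + 3) = 1 / (1 + 1 / (3 + 1 / convergent_cf (\<lambda>_. 2) n))" for n
    by (simp add: numeral_3_eq_3 a)
  moreover have "(\<lambda>n. 1 / (1 + 1 / (3 + 1 / convergent_cf (\<lambda>_. 2) n)))
      \<longlonglongrightarrow> 1 / (1 + 1 / (3 + 1 / (1 + sqrt 2)))"
  proof -
    have "1 + sqrt 2 > 0" "3 + 1 / (1 + sqrt 2) > 0" "1 + 1 / (3 + 1 / (1 + sqrt 2)) > 0"
      by (auto intro!: add_pos_pos divide_pos_pos)
    then show ?thesis by (intro tendsto_intros convergents_const_2) auto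
  qed
  ultimately have "(\<lambda>n. convergent_cf a (n + 3)) \<longlonglongrightarrow> 1 / (1 + 1 / (3 + 1 / (1 + sqrt 2)))"
    by simp
  moreover have "(\<lambda>n. convergent_cf a (n + 3)) \<longlonglongrightarrow> \<theta>"
    using assms LIMSEQ_ignore_initial_segment unfolding has_cf_expansion_def a_def by blast
  ultimately have "\<theta> = 1 / (1 + 1 / (3 + 1 / (1 + sqrt 2)))"
    using LIMSEQ_unique by blast
  also have "1 / (1 + sqrt 2) = sqrt 2 - 1"
    by (rule divide_eq_imp) (auto simp: algebra_simps add_nonneg_eq_0_iff)
  also have "1 / (1 + 1 / (3 + (sqrt 2 - 1))) = (2 + sqrt 2) / (3 + sqrt 2)"
  proof -
    have "2 + sqrt 2 > 0" "3 + sqrt 2 > 0" by (auto intro: add_pos_pos)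
    then show ?thesis by (simp add: field_simps)
  qed
  finally show ?thesis .
qed

text \<open>This is the solution \<open>r\<close> of
  \<open>r / (1 - r) = (2 + sqrt 2) / (3 + sqrt 2)\<close>.\<close>

definition La_freq :: real where
  "La_freq = (6 + sqrt 2) / 17"

lemma frequency_of_slope:
  assumes "r + s = 1" "(2 + sqrt 2) / (3 + sqrt 2) = r / s"
  shows "r = La_freq"
proof -
  have pos: "2 + sqrt 2 > 0" "3 + sqrt 2 > 0" by (auto intro: add_pos_pos)
  then have "r / s \<noteq> 0" using assms(2) by (metis divide_eq_0_iff less_irrefl)
  then have "s \<noteq> 0" by auto
  then have "r * (3 + sqrt 2) = s * (2 + sqrt 2)" using assms(2) pos by (simp add: field_simps)
  also have "s = 1 - r" using assms(1) by simp
  finally have "r * (5 + 2 * sqrt 2) = 2 + sqrt 2" by (simp add: algebra_simps)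
  \<comment> \<open>The conjugate turns the factor of \<open>r\<close> into its norm 25 - 8 =
    17.\<close>
  then have "r * (5 + 2 * sqrt 2) * (5 - 2 * sqrt 2) = (2 + sqrt 2) * (5 - 2 * sqrt 2)"
    by simp
  then have "17 * r = 6 + sqrt 2" by (simp add: algebra_simps)
  then show ?thesis by (simp add: La_freq_def)
qed

text \<open>Infinite descent: \<open>a\<close> is even, and \<open>b\<close> with half of
  \<open>a\<close> is a smaller solution.\<close>

lemma square_eq_twice_square:
  fixes a b :: nat
  assumes "a * a = 2 * (b * b)"
  shows "b = 0"
  using assms
proof (induction b arbitrary: a rule: less_induct)
  case (less b)
  show ?case
  proof (rule ccontr)
    assume "b \<noteq> 0"
    have "even (a * a)" using less.prems by simp
    then obtain c where c: "a = 2 * c" by (auto elim: evenE)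
    then have b: "b * b = 2 * (c * c)" using less.prems by simp
    have "c < b"
    proof (rule ccontr)
      assume "\<not> c < b"
      then have "b * b \<le> c * c" by (intro mult_le_mono) auto
      then show False using b \<open>b \<noteq> 0\<close> by simp
    qed
    then have "c = 0" using less.IH b by blast
    then show False using b \<open>b \<noteq> 0\<close> by simp
  qed
qed

text \<open>Makes the inequalities of \<open>standard_La_count_le\<close> strict.\<close>

lemma La_freq_irrational: "(real n + 1) * La_freq \<noteq> of_int k"
proof
  assume "(real n + 1) * La_freq = of_int k"
  then have "(real n + 1) * sqrt 2 = of_int (17 * k - 6 * (int n + 1))"
    by (simp add: La_freq_def field_simps)
  then have "((real n + 1) * sqrt 2) ^ 2 = of_int ((17 * k - 6 * (int n + 1)) ^ 2)"
    by simp
  then have "2 * (real n + 1) ^ 2 = of_int ((17 * k - 6 * (int n + 1)) ^ 2)"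
    by (simp add: power_mult_distrib)
  then have "of_int (2 * (int n + 1) ^ 2) = (of_int ((17 * k - 6 * (int n + 1)) ^ 2) :: real)"
    by simp
  then have "(17 * k - 6 * (int n + 1)) ^ 2 = 2 * (int n + 1) ^ 2"
    by (simp only: of_int_eq_iff)
  then have "int (nat \<bar>17 * k - 6 * (int n + 1)\<bar> * nat \<bar>17 * k - 6 * (int n + 1)\<bar>) = int (2 * (Suc n * Suc n))"
    by (simp add: power2_eq_square abs_mult_self_eq del: of_nat_Suc) (simp add: algebra_simps)
  then have "Suc n = 0"
    using square_eq_twice_square by (metis of_nat_eq_iff)
  then show False by simp
qed

lemma La_count_bounds:
  assumes "standard u" "has_slope u \<theta>" "has_cf_expansion \<theta> ([0, 1, 3] \<frown> [2]\<^sup>\<omega>)"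
  shows "of_int (La_count u n) < (real n + 1) * La_freq"
    and "(real n + 1) * La_freq < of_int (La_count u n) + 1"
proof -
  obtain r s where rs: "has_frequency u La r" "has_frequency u Lb s" "\<theta> = r / s"
    using assms(2) unfolding has_slope_def by blast
  have "r = La_freq"
    using frequency_of_slope[OF frequencies_sum[OF rs(1,2)]] slope_value[OF assms(3)] rs(3) by simp
  then show "of_int (La_count u n) < (real n + 1) * La_freq"
    "(real n + 1) * La_freq < of_int (La_count u n) + 1"
    using standard_La_count_le[OF assms(1) rs(1), of n] La_freq_irrational[of n "La_count u n"]
      La_freq_irrational[of n "La_count u n + 1"] by auto
qed

section \<open>Return times of rotations\<close>

text \<open>The interval \<open>[c, c + L)\<close> is long enough for one of the two opposite steps to stay inside it
  from any of its points, both forwards and backwards in time.\<close>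

lemma orbit_hits_window:
  fixes \<beta> c L :: real and q q' r r' n0 w0 N M :: int
  assumes q: "0 < q" "q \<le> M" "0 < q'" "q' \<le> M"
    and steps: "0 < q * \<beta> - r" "q' * \<beta> - r' < 0" "(q * \<beta> - r) - (q' * \<beta> - r') \<le> L"
    and start: "c \<le> n0 * \<beta> - w0" "n0 * \<beta> - w0 < c + L"
  obtains n w :: int where "N \<le> n" "n < N + M" "c \<le> n * \<beta> - w" "n * \<beta> - w < c + L"
proof -
  define H where "H n \<longleftrightarrow> (\<exists>w::int. c \<le> n * \<beta> - w \<and> n * \<beta> - w < c + L)" for n :: int
  have fwd: "H (n + q) \<or> H (n + q')" if "H n" for n
  proof -
    from that obtain w :: int where w: "c \<le> n * \<beta> - w" "n * \<beta> - w < c + L"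
      unfolding H_def by blast
    show ?thesis
    proof (cases "n * \<beta> - w + (q * \<beta> - r) < c + L")
      case True
      then have "c \<le> (n + q) * \<beta> - of_int (w + r) \<and> (n + q) * \<beta> - of_int (w + r) < c + L"
        using w steps by (simp add: algebra_simps)
      then show ?thesis unfolding H_def by blast
    next
      case False
      then have "c \<le> (n + q') * \<beta> - of_int (w + r') \<and> (n + q') * \<beta> - of_int (w + r') < c + L"
        using w steps by (simp add: algebra_simps)
      then show ?thesis unfolding H_def by blast
    qed
  qed
  have bwd: "H (n - q) \<or> H (n - q')" if "H n" for n
  proof -
    from that obtain w :: int where w: "c \<le> n * \<beta> - w" "n * \<beta> - w < c + L"
      unfolding H_def by blast
    show ?thesis
    proof (cases "c \<le> n * \<beta> - w - (q * \<beta> - r)")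
      case True
      then have "c \<le> (n - q) * \<beta> - of_int (w - r) \<and> (n - q) * \<beta> - of_int (w - r) < c + L"
        using w steps by (simp add: algebra_simps)
      then show ?thesis unfolding H_def by blast
    next
      case False
      then have "c \<le> (n - q') * \<beta> - of_int (w - r') \<and> (n - q') * \<beta> - of_int (w - r') < c + L"
        using w steps by (simp add: algebra_simps)
      then show ?thesis unfolding H_def by blast
    qed
  qed
  \<comment> \<open>The starting time \<open>n0\<close> may lie anywhere, so forward steps first
    lead to a hit beyond \<open>N\<close>.\<close>
  have "\<exists>n\<ge>n0 + int k. H n" for k
  proof (induction k)
    case 0
    then show ?case using start unfolding H_def by auto
  next
    case (Suc k)
    then obtain n where n: "n \<ge> n0 + int k" "H n" by blast
    then obtain n' where "n < n'" "H n'"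
      using fwd[OF n(2)] q(1,3) by (meson less_add_same_cancel1)
    then show ?case using n by (intro exI[of _ n']) auto
  qed
  then obtain n where "n0 + int (nat (N - n0)) \<le> n" "H n" by blast
  then have n: "N \<le> n" "H n" by (simp_all split: if_splits)
  \<comment> \<open>Backward steps have length at most \<open>M\<close> and hence cannot jump over
    the window of \<open>M\<close> times.\<close>
  have "\<exists>n'. N \<le> n' \<and> n' < N + M \<and> H n'"
    using n
  proof (induction "nat (n - N)" arbitrary: n rule: less_induct)
    case less
    show ?case
    proof (cases "n < N + M")
      case True
      then show ?thesis using less.prems by blast
    next
      case False
      obtain n' where "H n'" "N \<le> n'" "n' < n"
        using bwd[OF less.prems(2)] q False by (elim disjE) auto
      then show ?thesis using less.hyps[of n'] less.prems by simp
    qed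
  qed
  then show ?thesis using that unfolding H_def by blast
qed

text \<open>The bounds say that \<open>La_count u n\<close> is the floor of
  \<open>(n + 1) * \<alpha>\<close>, which is never an integer: \<open>u\<close> is the
  characteristic word of the rotation by \<alpha>.\<close>

locale mechanical =
  fixes u :: "letter word" and \<alpha> :: real
  assumes lower: "of_int (La_count u n) < (real n + 1) * \<alpha>"
    and upper: "(real n + 1) * \<alpha> < of_int (La_count u n) + 1"
begin

lemma window_bounds:
  "real n * \<alpha> - 1 < of_int (La_count u (j + n) - La_count u j)"
  "of_int (La_count u (j + n) - La_count u j) < real n * \<alpha> + 1"
  using lower[of j] upper[of j] lower[of "j + n"] upper[of "j + n"]
  by (simp_all add: algebra_simps)

text \<open>Put \<open>\<delta> = p * \<alpha> - P\<close>. Constancy says that no integer lies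
  between \<open>n * \<alpha>\<close> and \<open>n * \<alpha> + \<delta>\<close> for the
  \<open>m + 1\<close> times \<open>n\<close> from \<open>i + 1\<close> on. If \<open>M\<close> were
  at most \<open>m + 1\<close>, \<open>orbit_hits_window\<close> would produce such an
  integer.\<close>

lemma constant_shift_bound_aux:
  fixes q q' r r' M P :: int
  assumes const: "\<And>k. k \<le> m \<Longrightarrow> La_count u (i + k + p) - La_count u (i + k) = P"
    and q: "0 < q" "q \<le> M" "0 < q'" "q' \<le> M"
    and steps: "0 < q * \<alpha> - r" "q' * \<alpha> - r' < 0"
    and L: "(q * \<alpha> - r) - (q' * \<alpha> - r') \<le> \<bar>p * \<alpha> - P\<bar>"
  shows "int m + 1 < M"
proof (rule ccontr)
  assume M: "\<not> int m + 1 < M"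
  define \<delta> where "\<delta> = p * \<alpha> - P"
  have S: False if "int i + 1 \<le> n" "n < int i + 1 + M"
      "0 < \<delta> \<and> - \<delta> \<le> n * \<alpha> - w \<and> n * \<alpha> - w < 0 \<or> \<delta> < 0 \<and> 0 \<le> n * \<alpha> - w \<and> n * \<alpha> - w < - \<delta>" for n w :: int
  proof -
    define k where "k = nat (n - int i - 1)"
    have k: "k \<le> m" "n = int (i + k) + 1" using that(1,2) M by (auto simp: k_def)
    have n: "real_of_int n = real (i + k) + 1" using k by simp
    have "La_count u (i + k + p) - La_count u (i + k) = P" using const k by blast
    then have P: "real_of_int (La_count u (i + k + p)) = real_of_int (La_count u (i + k)) + P"
      by linarith
    have e: "(real (i + k + p) + 1) * \<alpha> = n * \<alpha> + p * \<alpha>" by (simp add: n algebra_simps)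
    have b: "of_int (La_count u (i + k)) < n * \<alpha>" "n * \<alpha> < of_int (La_count u (i + k)) + 1"
      "n * \<alpha> + \<delta> < of_int (La_count u (i + k)) + 1"
      "of_int (La_count u (i + k)) < n * \<alpha> + \<delta>"
      using lower[of "i + k"] upper[of "i + k"] lower[of "i + k + p"] upper[of "i + k + p"]
      unfolding e P n[symmetric] \<delta>_def by linarith+
    from that(3) show False
    proof
      assume *: "0 < \<delta> \<and> - \<delta> \<le> n * \<alpha> - w \<and> n * \<alpha> - w < 0"
      then have "real_of_int (La_count u (i + k)) < of_int w"
        "real_of_int w < of_int (La_count u (i + k) + 1)" using b by simp_all
      then show False by (simp only: of_int_less_iff)
    next
      assume *: "\<delta> < 0 \<and> 0 \<le> n * \<alpha> - w \<and> n * \<alpha> - w < - \<delta>"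
      then have "real_of_int (La_count u (i + k)) < of_int w"
        "real_of_int w < of_int (La_count u (i + k) + 1)" using b by simp_all
      then show False by (simp only: of_int_less_iff)
    qed
  qed
  have "\<delta> \<noteq> 0" using L steps unfolding \<delta>_def by linarith
  then consider "\<delta> > 0" | "\<delta> < 0" by linarith
  then show False
  proof cases
    case 1
    \<comment> \<open>The half-open interval from \<open>- \<delta>\<close> to 0 excludes 0, so the
      orbit starts at the negative step \<open>q' * \<alpha> - r'\<close>, which \<open>L\<close>
      keeps above \<open>- \<delta>\<close>.\<close>
    obtain n w :: int where "int i + 1 \<le> n" "n < int i + 1 + M" "- \<delta> \<le> n * \<alpha> - w" "n * \<alpha> - w < - \<delta> + \<delta>"
      by (rule orbit_hits_window[of q M q' \<alpha> r r' \<delta> "- \<delta>" q' r' "int i + 1"])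
        (use q steps L 1 in \<open>auto simp: \<delta>_def[symmetric]\<close>)
    then show False using S[of n w] 1 by simp
  next
    case 2
    obtain n w :: int where "int i + 1 \<le> n" "n < int i + 1 + M" "0 \<le> n * \<alpha> - w" "n * \<alpha> - w < 0 + (- \<delta>)"
      by (rule orbit_hits_window[of q M q' \<alpha> r r' "- \<delta>" 0 0 0 "int i + 1"])
        (use q steps L 2 in \<open>auto simp: \<delta>_def[symmetric]\<close>)
    then show False using S[of n w] 2 by simp
  qed
qed

lemma constant_shift_bound:
  fixes q q' r r' M P :: int
  assumes const: "\<And>k. k \<le> m \<Longrightarrow> La_count u (i + k + p) - La_count u (i + k) = P"
    and q: "0 < q" "q \<le> M" "0 < q'" "q' \<le> M"
    and opposite: "(q * \<alpha> - r) * (q' * \<alpha> - r') < 0"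
    and L: "\<bar>q * \<alpha> - r\<bar> + \<bar>q' * \<alpha> - r'\<bar> \<le> \<bar>p * \<alpha> - P\<bar>"
  shows "int m + 1 < M"
proof (cases "0 < q * \<alpha> - r")
  case True
  then have "q' * \<alpha> - r' < 0" using opposite by (simp add: mult_less_0_iff)
  then show ?thesis
    using True L by (intro constant_shift_bound_aux[OF const q]) auto
next
  case False
  then have "q * \<alpha> - r < 0" "0 < q' * \<alpha> - r'" using opposite by (auto simp: mult_less_0_iff)
  then show ?thesis
    using L by (intro constant_shift_bound_aux[OF const q(3,4,1,2)]) auto
qed

end

section \<open>Rational approximation of the frequency\<close>

text \<open>Denominators and numerators of the convergents of
  \<open>La_freq = [0, 2, 3, 2, 2, \<dots>]\<close>, starting with \<open>1 / 2\<close>.\<close>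

fun conv_den :: "nat \<Rightarrow> int" where
  "conv_den 0 = 2"
| "conv_den (Suc 0) = 7"
| "conv_den (Suc (Suc n)) = 2 * conv_den (Suc n) + conv_den n"

fun conv_num :: "nat \<Rightarrow> int" where
  "conv_num 0 = 1"
| "conv_num (Suc 0) = 3"
| "conv_num (Suc (Suc n)) = 2 * conv_num (Suc n) + conv_num n"

text \<open>Closed form of \<open>\<bar>conv_den n * La_freq - conv_num n\<bar>\<close>. The ratio
  is the absolute value of the small root \<open>1 - sqrt 2\<close> of the characteristic equation
  \<open>t * t = 2 * t + 1\<close> of the recurrences.\<close>

definition conv_err :: "nat \<Rightarrow> real" where
  "conv_err n = (5 - 2 * sqrt 2) / 17 * (sqrt 2 - 1) ^ n"

lemma sqrt2_bounds: "1.4142 < sqrt 2" "sqrt 2 < 1.4143"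
  by (rule real_less_rsqrt real_less_lsqrt; simp add: power2_eq_square)+

lemma conv_err_pos: "0 < conv_err n"
  using sqrt2_bounds by (simp add: conv_err_def)

lemma conv_err_Suc: "conv_err (Suc n) = (sqrt 2 - 1) * conv_err n"
  by (simp add: conv_err_def)

lemma conv_den_err:
  "conv_den n * La_freq - conv_num n = - ((-1) ^ n * conv_err n)"
proof -
  define \<tau> where "\<tau> = 1 - sqrt 2"
  have \<tau>: "\<tau> * \<tau> = 2 * \<tau> + 1" by (simp add: \<tau>_def algebra_simps)
  define K where "K = (5 - 2 * sqrt 2) / 17"
  have "conv_den n * La_freq - conv_num n = - (K * \<tau> ^ n)"
  proof (induction n rule: conv_den.induct)
    case 2
    show ?case by (simp add: La_freq_def K_def \<tau>_def field_simps)
  next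
    case (3 n)
    have "conv_den (Suc (Suc n)) * La_freq - conv_num (Suc (Suc n))
        = 2 * (conv_den (Suc n) * La_freq - conv_num (Suc n)) + (conv_den n * La_freq - conv_num n)"
      by (simp add: algebra_simps)
    also have "\<dots> = - (K * ((2 * \<tau> + 1) * \<tau> ^ n))"
      unfolding 3 by (simp add: algebra_simps)
    also have "(2 * \<tau> + 1) * \<tau> ^ n = \<tau> ^ Suc (Suc n)"
      unfolding \<tau>[symmetric] by simp
    finally show ?case .
  qed (simp add: La_freq_def K_def field_simps)
  also have "\<tau> ^ n = (-1) ^ n * (sqrt 2 - 1) ^ n"
    by (simp add: \<tau>_def power_mult_distrib[symmetric])
  finally show ?thesis by (simp add: conv_err_def K_def)
qed

lemma conv_det: "conv_den n * conv_num (Suc n) - conv_den (Suc n) * conv_num n = - ((-1) ^ n)"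
  by (induction n) (simp_all add: algebra_simps)

lemma conv_den_pos: "0 < conv_den n"
  by (induction n rule: conv_den.induct) auto

lemma conv_den_mono: "2 * conv_den n \<le> conv_den (Suc n)"
  using conv_den_pos[of "n - 1"] by (cases n) auto

text \<open>For positive \<open>n\<close> already \<open>5 * conv_den n\<close> suffices, by
  \<open>conv_den_mono\<close>; the summand 10 covers \<open>n = 0\<close>, where the denominators
  are 2 and 7.\<close>

lemma conv_den_upper: "2 * conv_den (Suc n) \<le> 5 * conv_den n + 10"
  using conv_den_mono[of "n - 1"] by (cases n) auto

lemma best_approximation:
  fixes p P :: int
  assumes "0 < p" "p < conv_den (Suc n)"
  shows "conv_err n \<le> \<bar>p * La_freq - P\<bar>"
proof -
  define e :: int where "e = (-1) ^ n"
  have e: "e * e = 1" "\<bar>e\<bar> = 1"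
    by (simp_all add: e_def power_mult_distrib[symmetric] power_abs)
  \<comment> \<open>\<open>x\<close> and \<open>y\<close> are the coordinates of \<open>(p, P)\<close> in the basis formed by two consecutive convergents.
    The bounds on \<open>p\<close> force them to have opposite signs, so that the two errors add up.\<close>
  define x where "x = - e * (p * conv_num (Suc n) - P * conv_den (Suc n))"
  define y where "y = e * (p * conv_num n - P * conv_den n)"
  have det: "conv_den n * conv_num (Suc n) = conv_den (Suc n) * conv_num n - e"
    using conv_det[of n] by (simp add: e_def)
  have "x * conv_den n + y * conv_den (Suc n)
      = - e * p * (conv_den n * conv_num (Suc n) - conv_den (Suc n) * conv_num n)"
    by (simp add: x_def y_def algebra_simps)
  then have p: "p = x * conv_den n + y * conv_den (Suc n)"
    using e(1) by (simp add: det algebra_simps)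
  have "x * conv_num n + y * conv_num (Suc n)
      = - e * P * (conv_den n * conv_num (Suc n) - conv_den (Suc n) * conv_num n)"
    by (simp add: x_def y_def algebra_simps)
  then have P: "P = x * conv_num n + y * conv_num (Suc n)"
    using e(1) by (simp add: det algebra_simps)
  have "p * La_freq - P = x * (conv_den n * La_freq - conv_num n)
      + y * (conv_den (Suc n) * La_freq - conv_num (Suc n))"
    unfolding p P by (simp add: algebra_simps)
  also have "\<dots> = - (of_int e * (x * conv_err n - y * conv_err (Suc n)))"
    unfolding conv_den_err by (simp add: e_def algebra_simps)
  finally have eq: "\<bar>p * La_freq - P\<bar> = \<bar>x * conv_err n - y * conv_err (Suc n)\<bar>"
    using e(2) by (simp add: abs_mult) (metis of_int_abs of_int_1 mult_1)
  have den: "0 < conv_den n" "0 < conv_den (Suc n)" using conv_den_pos by auto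
  consider "x = 0" | "x > 0" | "x < 0" by linarith
  then show ?thesis
  proof cases
    case 1
    then have "0 < y * conv_den (Suc n)" using p assms by simp
    then have "1 \<le> y" using den by (simp add: zero_less_mult_iff)
    then have "conv_den (Suc n) \<le> y * conv_den (Suc n)" using den by simp
    moreover have "p = y * conv_den (Suc n)" using 1 p by simp
    ultimately show ?thesis using assms by linarith
  next
    case 2
    have "y \<le> 0"
    proof (rule ccontr)
      assume "\<not> y \<le> 0"
      then have "conv_den (Suc n) \<le> y * conv_den (Suc n)" using den by simp
      moreover have "0 < x * conv_den n" using 2 den by simp
      ultimately show False using p assms by linarith
    qed
    then have "y * conv_err (Suc n) \<le> 0"
      using conv_err_pos[of "Suc n"] by (simp add: mult_le_0_iff)
    moreover have "1 * conv_err n \<le> x * conv_err n"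
      using 2 conv_err_pos[of n] by (intro mult_right_mono) auto
    ultimately show ?thesis unfolding eq by linarith
  next
    case 3
    have "0 \<le> y"
    proof (rule ccontr)
      assume "\<not> 0 \<le> y"
      then have "y * conv_den (Suc n) < 0" "x * conv_den n < 0"
        using 3 den by (simp_all add: mult_less_0_iff)
      then show False using p assms by linarith
    qed
    then have "0 \<le> y * conv_err (Suc n)"
      using conv_err_pos[of "Suc n"] by simp
    moreover have "x * conv_err n \<le> -1 * conv_err n"
      using 3 conv_err_pos[of n] by (intro mult_right_mono) auto
    ultimately show ?thesis unfolding eq by linarith
  qed
qed

lemma conv_den_bracket:
  assumes "2 \<le> p"
  obtains n where "conv_den n \<le> p" "p < conv_den (Suc n)"
proof -
  have big: "int n < conv_den n" for n
  proof (induction n)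
    case (Suc n)
    then show ?case using conv_den_mono[of n] by simp
  qed simp
  let ?Q = "\<lambda>n. p < conv_den n"
  have "?Q (nat p)" using big[of "nat p"] assms by simp
  then obtain k where k: "?Q k" "\<And>j. j < k \<Longrightarrow> \<not> ?Q j"
    using exists_least_iff[of ?Q] by blast
  then obtain n where "k = Suc n" using assms by (cases k) auto
  then show ?thesis using k(1) k(2)[of n] that[of n] by simp
qed

text \<open>The decimals 0.43612 and 0.43614, precise enough for all numerical comparisons
  below.\<close>

lemma La_freq_bounds: "10903 / 25000 < La_freq" "La_freq < 21807 / 50000"
  using sqrt2_bounds by (simp_all add: La_freq_def)

locale silver_word = mechanical u La_freq for u
begin

text \<open>As \<open>p = 6 * p'\<close>, this is \<open>10 * m \<le> p\<close>. The avoided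
  interval has length \<open>6 * \<bar>p' * La_freq - P'\<bar>\<close>, bounded below through the
  convergent whose denominator is the last one not exceeding \<open>p'\<close>.\<close>

lemma shift_by_multiple_of_six:
  fixes p' P' :: int
  assumes p: "0 < p'" "int p = 6 * p'"
    and const: "\<And>k. k \<le> m \<Longrightarrow> La_count u (i + k + p) - La_count u (i + k) = 6 * P'"
  shows "5 * int m \<le> 3 * p'"
proof -
  have L: "\<bar>p * La_freq - of_int (6 * P')\<bar> = 6 * \<bar>p' * La_freq - P'\<bar>"
  proof -
    have "real p = 6 * of_int p'" using p(2) by (metis of_int_mult of_int_numeral of_int_of_nat_eq)
    then have "p * La_freq - of_int (6 * P') = 6 * (p' * La_freq - P')" by simp
    then show ?thesis by (simp only: abs_mult abs_numeral)
  qed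
  note bound = constant_shift_bound[OF const, unfolded L]
  show ?thesis
  proof (cases "p' = 1")
    case True
    have "1 / 6 \<le> \<bar>La_freq - P'\<bar>"
    proof (cases "P' \<le> 0")
      case True
      then have "real_of_int P' \<le> 0" by simp
      then have "1 / 6 \<le> La_freq - P'" using La_freq_bounds by linarith
      then show ?thesis by simp
    next
      case False
      then have "1 \<le> real_of_int P'" by simp
      then have "1 / 6 \<le> - (La_freq - P')" using La_freq_bounds by linarith
      then show ?thesis by simp
    qed
    then have "1 \<le> 6 * \<bar>La_freq - P'\<bar>" by simp
    \<comment> \<open>The steps \<open>La_freq\<close> and \<open>La_freq - 1\<close> both take time
      1 and have total length 1. The case is contradictory.\<close>
    then have "int m + 1 < 1"
      using True La_freq_bounds by (intro bound[of m 1 1 1 0 1]) (simp_all add: mult_less_0_iff)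
    then show ?thesis by simp
  next
    case False
    then have "2 \<le> p'" using p by simp
    then obtain n where n: "conv_den n \<le> p'" "p' < conv_den (Suc n)"
      using conv_den_bracket by blast
    have err: "conv_err n \<le> \<bar>p' * La_freq - P'\<bar>"
      using best_approximation[OF p(1) n(2)] .
    show ?thesis
    proof (cases n)
      case 0
      have "conv_err 0 = 1 - 2 * La_freq" by (simp add: conv_err_def La_freq_def field_simps)
      then have "1 - 2 * La_freq \<le> \<bar>p' * La_freq - P'\<bar>" using err 0 by simp
      \<comment> \<open>The steps \<open>La_freq\<close> and \<open>2 * La_freq - 1\<close> have
        total length \<open>1 - La_freq\<close>, which is below
        \<open>6 * (1 - 2 * La_freq)\<close>. Hence \<open>m = 0\<close>.\<close>
      then have "int m + 1 < 2"
        using La_freq_bounds by (intro bound[of m 1 2 2 0 1]) (simp_all add: mult_less_0_iff)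
      then show ?thesis using p by simp
    next
      case (Suc l)
      let ?q = "conv_den (Suc l) - conv_den l" and ?r = "conv_num (Suc l) - conv_num l"
      define s :: real where "s = (-1) ^ l"
      have s: "s * s = 1" "\<bar>s\<bar> = 1"
        by (simp_all add: s_def power_mult_distrib[symmetric] power_abs)
      have pos: "0 < conv_err l" "0 < conv_err (Suc l)" using conv_err_pos by auto
      have d1: "?q * La_freq - ?r = s * (conv_err (Suc l) + conv_err l)"
        using conv_den_err[of l] conv_den_err[of "Suc l"] by (simp add: s_def algebra_simps)
      have d2: "conv_den l * La_freq - conv_num l = - (s * conv_err l)"
        using conv_den_err[of l] by (simp add: s_def)
      have "int m + 1 < ?q"
      proof (rule bound[of m ?q ?q "conv_den l" ?r "conv_num l"])
        show "0 < ?q" "0 < conv_den l" "conv_den l \<le> ?q"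
          using conv_den_pos[of l] conv_den_mono[of l] by auto
        have "(?q * La_freq - ?r) * (conv_den l * La_freq - conv_num l)
            = - (s * s) * ((conv_err (Suc l) + conv_err l) * conv_err l)"
          unfolding d1 d2 by (simp add: algebra_simps)
        also have "\<dots> < 0" using pos s(1) by (simp add: add_pos_pos)
        finally show "(?q * La_freq - ?r) * (conv_den l * La_freq - conv_num l) < 0" .
        have "\<bar>?q * La_freq - ?r\<bar> + \<bar>conv_den l * La_freq - conv_num l\<bar>
            = conv_err (Suc l) + 2 * conv_err l"
          unfolding d1 d2 using pos s(2) by (simp add: abs_mult)
        \<comment> \<open>Here the factor six is decisive: \<open>5 * (sqrt 2 - 1)\<close> is just
          above 2.\<close>
        also have "\<dots> \<le> 6 * conv_err (Suc l)"
        proof -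
          have "2 * conv_err l \<le> 5 * (sqrt 2 - 1) * conv_err l"
            using pos sqrt2_bounds by (intro mult_right_mono) auto
          moreover have "5 * (sqrt 2 - 1) * conv_err l = 5 * conv_err (Suc l)"
            by (simp add: conv_err_Suc)
          ultimately show ?thesis by linarith
        qed
        finally show "\<bar>?q * La_freq - ?r\<bar> + \<bar>conv_den l * La_freq - conv_num l\<bar>
            \<le> 6 * \<bar>p' * La_freq - P'\<bar>"
          using err Suc by simp
      qed auto
      \<comment> \<open>Since \<open>m \<le> ?q - 2\<close>, five times \<open>m\<close> is at most
        \<open>5 * ?q - 10\<close>, and \<open>conv_den_upper\<close> bounds this by
        \<open>3 * conv_den (Suc l)\<close>.\<close>
      then show ?thesis using conv_den_upper[of l] n(1) Suc by simp
    qed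
  qed
qed

end

section \<open>Repetitions in the coloured sequence\<close>

lemma iter_123456: "([1, 2, 3, 4, 5, 6 :: nat]\<^sup>\<omega>) n = Suc (n mod 6)"
proof -
  have "n mod 6 = 0 \<or> n mod 6 = 1 \<or> n mod 6 = 2 \<or> n mod 6 = 3 \<or> n mod 6 = 4 \<or> n mod 6 = 5"
    by presburger
  then show ?thesis by (elim disjE) simp_all
qed

lemma colour_eq_iff:
  assumes "x = colour u ([1, 2, 3, 4, 5, 6 :: nat]\<^sup>\<omega>) ([1, 2, 3, 4, 5, 6 :: nat]\<^sup>\<omega>)"
  shows "x i = x (i + p) \<longleftrightarrow> u i = u (i + p) \<and>
    (if u i = La then 6 dvd La_count u (i + p) - La_count u i
     else 6 dvd int p - (La_count u (i + p) - La_count u i))"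
proof -
  define y where "y = ([1, 2, 3, 4, 5, 6 :: nat]\<^sup>\<omega>)"
  have y: "y n = Suc (n mod 6)" for n
    unfolding y_def by (rule iter_123456)
  have m: "a mod 6 = b mod 6 \<longleftrightarrow> 6 dvd int b - int a" for a b :: nat
  proof -
    have "a mod 6 = b mod 6 \<longleftrightarrow> int (b mod 6) = int (a mod 6)" by auto
    also have "\<dots> \<longleftrightarrow> 6 dvd int b - int a" by (simp add: zmod_int mod_eq_dvd_iff)
    finally show ?thesis .
  qed
  have b: "int (count_list (prefix (i + p) u) Lb) - int (count_list (prefix i u) Lb)
      = int p - (La_count u (i + p) - La_count u i)"
    by (simp add: count_Lb)
  show ?thesis
    by (cases "u i"; cases "u (i + p)")
      (simp_all add: assms[folded y_def] colour_def y m b La_count_def)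
qed

context silver_word
begin

text \<open>If both letters occur in the repeated part, six divides \<open>p\<close> and
  \<open>P\<close>, and the rotation argument applies. Otherwise that part is one \<open>La\<close>
  or at most two \<open>Lb\<close>, and frequency bounds suffice.\<close>

lemma repetition_bound:
  assumes x: "x = colour u ([1, 2, 3, 4, 5, 6 :: nat]\<^sup>\<omega>) ([1, 2, 3, 4, 5, 6 :: nat]\<^sup>\<omega>)"
    and rep: "\<And>k. k < m \<Longrightarrow> x (i + k) = x (i + k + p)" and p: "0 < p"
  shows "10 * m \<le> p"
proof (cases "m = 0")
  case False
  define S where "S = La_count u"
  define P where "P = S (i + p) - S i"
  have S_Suc: "S (Suc k) = S k + (if u k = La then 1 else 0)" for k
    by (simp add: S_def La_count_Suc)
  have eq: "u (i + k) = u (i + k + p)" if "k < m" for k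
    using rep[OF that] unfolding colour_eq_iff[OF x] by blast
  have const: "S (i + k + p) - S (i + k) = P" if "k \<le> m" for k
    using that
  proof (induction k)
    case (Suc k)
    then show ?case using eq[of k] S_Suc[of "i + k"] S_Suc[of "i + k + p"] by simp
  qed (simp add: P_def)
  have dvd: "if u (i + k) = La then 6 dvd P else 6 dvd int p - P" if "k < m" for k
  proof -
    have "La_count u (i + k + p) - La_count u (i + k) = P" using const[of k] that by (simp add: S_def)
    from rep[OF that, unfolded colour_eq_iff[OF x] this] show ?thesis by blast
  qed
  have up: "of_int (S (j + n) - S j) < real n * La_freq + 1"
    and lo: "real n * La_freq - 1 < of_int (S (j + n) - S j)" for j n
    using window_bounds unfolding S_def by blast+
  consider (both) k l where "k < m" "l < m" "u (i + k) = La" "u (i + l) = Lb"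
    | (a) "\<And>k. k < m \<Longrightarrow> u (i + k) = La" | (b) "\<And>k. k < m \<Longrightarrow> u (i + k) = Lb"
    using letter_neq by metis
  then show ?thesis
  proof cases
    case both
    have "6 dvd P" "6 dvd int p - P" using dvd[of k] dvd[of l] both by auto
    then have "6 dvd int p" by (metis dvd_diff_right_iff dvd_add_left_iff diff_add_cancel dvd_add)
    then obtain p' P' where p': "int p = 6 * p'" and P': "P = 6 * P'"
      using \<open>6 dvd P\<close> by (auto elim!: dvdE)
    have "5 * int m \<le> 3 * p'"
      using p p' P' const by (intro shift_by_multiple_of_six[of p' p m i P']) (auto simp: S_def)
    then show ?thesis using p' by simp
  next
    case a
    have m: "m = 1"
    proof (rule ccontr)
      assume "m \<noteq> 1"
      then have "u i = La" "u (Suc i) = La" using a[of 0] a[of 1] False by auto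
      then have "S (i + 2) - S i = 2" using S_Suc[of i] S_Suc[of "Suc i"] by simp
      then show False using up[of i 2] La_freq_bounds by simp
    qed
    have "u i = La" "u (i + p) = La" using a[of 0] eq[of 0] m by auto
    then have "S (Suc i) - S i = 1" "S (Suc (i + p)) - S (i + p) = 1" using S_Suc by auto
    \<comment> \<open>Dropping the \<open>La\<close> at position \<open>i\<close> sharpens the lower
      bound enough to give \<open>0 < P\<close>, hence \<open>6 \<le> P\<close>.\<close>
    then have 1: "S (Suc i + (p - 1)) - S (Suc i) = P - 1" using p by (simp add: P_def)
    have "6 dvd P" using dvd[of 0] m \<open>u i = La\<close> by simp
    have "real (p - 1) * La_freq < of_int P" using lo[of "p - 1" "Suc i"] unfolding 1 by simp
    moreover have "0 \<le> real (p - 1) * La_freq" using La_freq_bounds by simp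
    ultimately have "0 < real_of_int P" by linarith
    then have "6 \<le> P" using \<open>6 dvd P\<close> by (simp add: zdvd_imp_le)
    have "10 \<le> p"
    proof (rule ccontr)
      assume "\<not> 10 \<le> p"
      then have "real p * La_freq \<le> 9 * La_freq"
        using La_freq_bounds by (intro mult_right_mono) auto
      then have "real_of_int P < 6" using up[of i p] La_freq_bounds unfolding P_def by linarith
      then show False using \<open>6 \<le> P\<close> by simp
    qed
    then show ?thesis using m by simp
  next
    case b
    have m: "m \<le> 2"
    proof (rule ccontr)
      assume "\<not> m \<le> 2"
      then have "u i = Lb" "u (Suc i) = Lb" "u (Suc (Suc i)) = Lb"
        using b[of 0] b[of 1] b[of 2] by auto
      then have "S (i + 3) - S i = 0"
        using S_Suc[of i] S_Suc[of "Suc i"] S_Suc[of "Suc (Suc i)"] by (simp add: numeral_3_eq_3)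
      then show False using lo[of 3 i] La_freq_bounds by simp
    qed
    have "u i = Lb" "u (i + p) = Lb" using b[of 0] eq[of 0] False by auto
    then have eqs: "S (Suc i) = S i" "S (Suc (i + p)) = S (i + p)" using S_Suc by auto
    have dvd6: "6 dvd int p - P" using dvd[of 0] False \<open>u i = Lb\<close> by simp
    have p1: "real (p - 1) = real p - 1" using p by simp
    \<comment> \<open>The letters at \<open>i\<close> and \<open>i + p\<close> are
      \<open>Lb\<close>, so windows one shorter and one longer than \<open>p\<close> still contain
      \<open>P\<close> letters \<open>La\<close>; this sharpens both bounds.\<close>
    have "S (Suc i + (p - 1)) - S (Suc i) = P" "S (i + (p + 1)) - S i = P"
      using p eqs by (simp_all add: P_def)
    then have P: "of_int P < (real p - 1) * La_freq + 1" "(real p + 1) * La_freq - 1 < of_int P"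
      using up[of "Suc i" "p - 1"] lo[of "p + 1" i] p1 by (simp_all add: add.commute)
    have "0 \<le> (real p - 1) * (1 - La_freq)" using p La_freq_bounds by simp
    then have "real_of_int P < real p" using P(1) by (simp add: algebra_simps)
    then have "P < int p" by linarith
    then have six: "6 \<le> int p - P" using dvd6 by (simp add: zdvd_imp_le)
    then have six': "6 \<le> real p - of_int P" by linarith
    have p10: "10 \<le> p"
    proof (rule ccontr)
      assume "\<not> 10 \<le> p"
      then have "real p * (1 - La_freq) \<le> 9 * (1 - La_freq)"
        using La_freq_bounds by (intro mult_right_mono) auto
      then show False using P(2) six' La_freq_bounds by (simp add: algebra_simps)
    qed
    show ?thesis
    proof (cases "m = 2")
      case True
      have "u (Suc i) = Lb" "u (Suc (i + p)) = Lb" using b[of 1] eq[of 1] True by auto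
      then have eqs2: "S (Suc (Suc i)) = S i" "S (Suc (Suc (i + p))) = S (i + p)"
        using S_Suc eqs by auto
      have p2: "real (p - 2) = real p - 2" using p10 by simp
      have "Suc (Suc i) + (p - 2) = i + p" "i + (p + 2) = Suc (Suc (i + p))"
        using p10 by simp_all
      then have "S (Suc (Suc i) + (p - 2)) - S (Suc (Suc i)) = P" "S (i + (p + 2)) - S i = P"
        unfolding P_def by (simp_all only: eqs2)
      then have P2: "of_int P < (real p - 2) * La_freq + 1" "(real p + 2) * La_freq - 1 < of_int P"
        using up[of "Suc (Suc i)" "p - 2"] lo[of "p + 2" i] p2 by (simp_all add: add.commute)
      have "20 \<le> p"
      proof (rule ccontr)
        assume "\<not> 20 \<le> p"
        then have "real p * (1 - La_freq) \<le> 19 * (1 - La_freq)"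
          using La_freq_bounds by (intro mult_right_mono) auto
        then have "real p - of_int P < 12" using P2(2) La_freq_bounds by (simp add: algebra_simps)
        then have "int p - P < 12" by linarith
        moreover obtain t where t: "int p - P = 6 * t" using dvd6 by (auto elim: dvdE)
        ultimately have "t = 1" using six by linarith
        then have "int p - P = 6" using t by simp
        then have e: "real_of_int P = real p - 6" by linarith
        \<comment> \<open>With \<open>p - P = 6\<close>: for \<open>p = 10\<close> the twelve
          letters from \<open>i\<close> on would contain only four \<open>La\<close>; for larger
          \<open>p\<close> the \<open>p - 2\<close> letters after the two \<open>Lb\<close> would
          contain only four \<open>Lb\<close>. Both are too few.\<close>
        show False
        proof (cases "p \<le> 10")
          case True
          then show False using p10 P2 e La_freq_bounds by simp
        next
          case False
          then have "11 * (1 - La_freq) \<le> real p * (1 - La_freq)"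
            using La_freq_bounds by (intro mult_right_mono) auto
          then show False using P2(1) e La_freq_bounds by (simp add: algebra_simps)
        qed
      qed
      then show ?thesis using True by simp
    next
      case False
      then show ?thesis using p10 m by simp
    qed
  qed
qed simp

text \<open>The ten letters from position 4 on contain four \<open>La\<close> and six
  \<open>Lb\<close>, one full turn of the colours of \<open>Lb\<close>; positions 4 and 14 both
  carry \<open>Lb\<close>.\<close>

lemma repetition_at_distance_10:
  assumes x: "x = colour u ([1, 2, 3, 4, 5, 6 :: nat]\<^sup>\<omega>) ([1, 2, 3, 4, 5, 6 :: nat]\<^sup>\<omega>)"
  shows "x 4 = x 14"
proof -
  have S: "La_count u n = c" if "of_int c < (real n + 1) * La_freq" "(real n + 1) * La_freq < of_int c + 1" for n c
    using lower[of n] upper[of n] that by linarith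
  have "La_count u 4 = 2" "La_count u 5 = 2" "La_count u 14 = 6" "La_count u 15 = 6"
    using La_freq_bounds by (intro S; simp)+
  then have "u 4 = Lb" "u 14 = Lb" "La_count u (4 + 10) - La_count u 4 = 4"
    using La_count_Suc[of u 4] La_count_Suc[of u 14] letter_neq by (auto split: if_splits)
  then show ?thesis using colour_eq_iff[OF x, of 4 10] by simp
qed

end

text \<open>A factor \<open>z\<close> of period \<open>p\<close> repeats its first
  \<open>length z - p\<close> letters at distance \<open>p\<close>, so \<open>bound\<close> gives
  \<open>10 * length z \<le> 11 * p\<close>. The factor of length 11 at \<open>i\<close> has period
  10 and attains the supremum.\<close>

lemma critical_exponent_eqI:
  assumes bound: "\<And>i m p. \<lbrakk>0 < p; \<And>k. k < m \<Longrightarrow> x (i + k) = x (i + k + p)\<rbrakk> \<Longrightarrow> 10 * m \<le> p"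
    and rep: "x i = x (i + 10)"
  shows "critical_exponent x = ereal (11 / 10)"
proof -
  have ex: "is_period z (least_period z)" if "z \<noteq> []" for z :: "'a list"
    unfolding least_period_def
    by (rule LeastI[of _ "length z"]) (use that in \<open>simp add: is_period_def\<close>)
  have "exponent z \<le> 11 / 10" if z: "z \<noteq> []" "factor x z" for z
  proof -
    define p where "p = least_period z"
    have per: "0 < p" "\<And>k. k + p < length z \<Longrightarrow> z ! (k + p) = z ! k"
      using ex[OF z(1)] by (simp_all add: p_def is_period_def)
    obtain i where i: "\<And>k. k < length z \<Longrightarrow> z ! k = x (i + k)"
      using z(2) unfolding factor_iff_nth by blast
    have "10 * (length z - p) \<le> p"
    proof (rule bound[OF per(1)])
      fix k assume "k < length z - p"
      then show "x (i + k) = x (i + k + p)"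
        using per(2)[of k] i[of k] i[of "k + p"] by (simp add: add.assoc)
    qed
    then have "10 * real (length z) \<le> 11 * real p" by linarith
    then show ?thesis using per(1) by (simp add: exponent_def p_def[symmetric] field_simps)
  qed
  moreover have "\<exists>z. z \<noteq> [] \<and> factor x z \<and> 11 / 10 \<le> exponent z"
  proof (intro exI conjI)
    let ?z = "x [i \<rightarrow> i + 11]"
    show "?z \<noteq> []" by simp
    show "factor x ?z" by (rule factor_subsequence)
    have "is_period ?z 10" using rep by (auto simp: is_period_def)
    then have "least_period ?z \<le> 10" unfolding least_period_def by (rule Least_le)
    moreover have "0 < least_period ?z" using ex[of ?z] by (simp add: is_period_def)
    ultimately show "11 / 10 \<le> exponent ?z" by (simp add: exponent_def field_simps)
  qed
  ultimately show ?thesis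
    unfolding critical_exponent_def
    by (intro antisym SUP_least) (auto intro: SUP_upper2)
qed

section \<open>Balancedness of the coloured sequence\<close>

text \<open>For natural \<open>t\<close>, \<open>(t + e) div 6\<close> counts the numbers below
  \<open>t\<close> with residue \<open>5 - e\<close>; this is the recurrence of that count.\<close>

lemma residue_count_Suc:
  fixes t e :: int
  assumes "0 \<le> e" "e < 6"
  shows "(t + 1 + e) div 6 = (t + e) div 6 + (if t mod 6 = 5 - e then 1 else 0)"
proof -
  define q s where "q = t div 6" and "s = t mod 6"
  have t: "t = 6 * q + s" and s: "0 \<le> s" "s < 6"
    by (simp_all add: q_def s_def)
  have div: "(6 * q + v) div 6 = q + (if 6 \<le> v then 1 else 0)" if "0 \<le> v" "v < 12" for v
    using that by (simp add: div_pos_geq)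
  show ?thesis
    using div[of "s + 1 + e"] div[of "s + e"] assms s unfolding s_def[symmetric]
    by (auto simp: t algebra_simps)
qed

lemma count_list_prefix_Suc:
  "count_list (prefix (Suc n) x) c = count_list (prefix n x) c + (if x n = c then 1 else 0)"
  by simp

text \<open>A colour marks every sixth occurrence of its letter. The case \<open>absent\<close> is
  for labels outside 1 to 6.\<close>

lemma colour_count:
  assumes x: "x = colour u ([1, 2, 3, 4, 5, 6 :: nat]\<^sup>\<omega>) ([1, 2, 3, 4, 5, 6 :: nat]\<^sup>\<omega>)"
  obtains (absent) "\<And>n. count_list (prefix n x) c = 0"
  | (La) e where "\<And>n. int (count_list (prefix n x) c) = (La_count u n + e) div 6"
  | (Lb) e where "\<And>n. int (count_list (prefix n x) c) = (int n - La_count u n + e) div 6"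
proof -
  define y where "y = ([1, 2, 3, 4, 5, 6 :: nat]\<^sup>\<omega>)"
  have y: "y n = Suc (n mod 6)" for n
    unfolding y_def by (rule iter_123456)
  have x_nth: "x n = (case u n of La \<Rightarrow> Inl (Suc (count_list (prefix n u) La mod 6))
      | Lb \<Rightarrow> Inr (Suc (count_list (prefix n u) Lb mod 6)))" for n
    by (cases "u n") (simp_all add: x[folded y_def] colour_def y)
  have absent_case: thesis if "\<And>n. x n \<noteq> c"
  proof (rule absent)
    show "count_list (prefix n x) c = 0" for n
      using that by (induction n) simp_all
  qed
  show thesis
  proof (cases "\<exists>j<6. c = Inl (Suc j) \<or> c = Inr (Suc j)")
    case False
    have "c \<noteq> Inl (Suc (k mod 6))" "c \<noteq> Inr (Suc (k mod 6))" for k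
      using False[simplified, rule_format, of "k mod 6"] by simp_all
    then have "x n \<noteq> c" for n
      unfolding x_nth by (metis letter.exhaust letter.simps(3,4))
    then show thesis by (rule absent_case)
  next
    case True
    then obtain j where j: "j < 6" "c = Inl (Suc j) \<or> c = Inr (Suc j)" by blast
    define e where "e = 5 - int j"
    have e: "0 \<le> e" "e < 6" "5 - e = int j" using j by (auto simp: e_def)
    have mod: "int k mod 6 = int j \<longleftrightarrow> k mod 6 = j" for k
      by (metis of_nat_eq_iff of_nat_mod of_nat_numeral)
    from j(2) show thesis
    proof
      assume c: "c = Inl (Suc j)"
      have xc: "x n = c \<longleftrightarrow> u n = La \<and> La_count u n mod 6 = 5 - e" for n
        unfolding e(3) La_count_def mod by (cases "u n") (simp_all add: x_nth c)
      have "int (count_list (prefix n x) c) = (La_count u n + e) div 6" for n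
      proof (induction n)
        case (Suc n)
        then show ?case
          using residue_count_Suc[OF e(1,2), of "La_count u n"]
          unfolding count_list_prefix_Suc La_count_Suc xc by (cases "u n") simp_all
      qed (use e in simp)
      then show thesis by (rule La)
    next
      assume c: "c = Inr (Suc j)"
      have xc: "x n = c \<longleftrightarrow> u n = Lb \<and> (int n - La_count u n) mod 6 = 5 - e" for n
        unfolding e(3) count_Lb[symmetric] mod by (cases "u n") (simp_all add: x_nth c)
      have "int (count_list (prefix n x) c) = (int n - La_count u n + e) div 6" for n
      proof (induction n)
        case (Suc n)
        have T_Suc: "int (Suc n) - La_count u (Suc n) = int n - La_count u n + (if u n = Lb then 1 else 0)"
          by (cases "u n") (simp_all add: La_count_Suc)
        show ?case
          using residue_count_Suc[OF e(1,2), of "int n - La_count u n"] Suc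
          unfolding count_list_prefix_Suc xc T_Suc by (cases "u n") simp_all
      qed (use e in simp)
      then show thesis by (rule Lb)
    qed
  qed
qed

text \<open>The remainders contribute at least -10 to \<open>(A - a) - (B - b)\<close>, so the
  difference \<open>D\<close> of the quotients satisfies \<open>6 * D - 10 \<le> 1\<close>.\<close>

lemma residue_count_balanced:
  fixes a b A B :: int
  assumes "A - a \<le> B - b + 1"
  shows "(A div 6 - a div 6) - (B div 6 - b div 6) \<le> 1"
proof -
  have "z = 6 * (z div 6) + z mod 6 \<and> 0 \<le> z mod 6 \<and> z mod 6 < 6" for z :: int
    by simp
  from this[of A] this[of a] this[of B] this[of b] assms show ?thesis
    by linarith
qed

lemma count_list_subsequence:
  "int (count_list (x [i \<rightarrow> i + n]) c) = int (count_list (prefix (i + n) x) c) - int (count_list (prefix i x) c)"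
  by (simp add: subsequence_append)

lemma colour_balanced:
  assumes u: "La_balanced u"
    and x: "x = colour u ([1, 2, 3, 4, 5, 6 :: nat]\<^sup>\<omega>) ([1, 2, 3, 4, 5, 6 :: nat]\<^sup>\<omega>)"
  shows "balanced x"
proof -
  have "int (count_list (x [i \<rightarrow> i + n]) c) - int (count_list (x [j \<rightarrow> j + n]) c) \<le> 1" for i j n c
  proof -
    have bal: "La_count u (i + n) - La_count u i \<le> La_count u (j + n) - La_count u j + 1"
      "La_count u (j + n) - La_count u j \<le> La_count u (i + n) - La_count u i + 1"
      using u unfolding La_balanced_def by blast+
    consider (absent) "\<And>n. count_list (prefix n x) c = 0"
      | (La) e where "\<And>n. int (count_list (prefix n x) c) = (La_count u n + e) div 6"
      | (Lb) e where "\<And>n. int (count_list (prefix n x) c) = (int n - La_count u n + e) div 6"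
      by (rule colour_count[OF x, of c]) blast+
    then show ?thesis
    proof cases
      case absent
      then show ?thesis unfolding count_list_subsequence by simp
    next
      case (La e)
      show ?thesis unfolding count_list_subsequence La
        by (rule residue_count_balanced) (use bal in simp)
    next
      case (Lb e)
      show ?thesis unfolding count_list_subsequence Lb
        by (rule residue_count_balanced) (use bal in simp)
    qed
  qed
  then show ?thesis unfolding balanced_def factor_def by metis
qed

theorem theorem5:
  fixes u :: "letter word" and \<theta> :: real
    and y y' :: "nat word" and x12 :: "(nat + nat) word"
  assumes "standard u"
    and "has_slope u \<theta>"
    and "has_cf_expansion \<theta> ([0, 1, 3] \<frown> [2]\<^sup>\<omega>)"
    and "y = [1, 2, 3, 4, 5, 6]\<^sup>\<omega>"
    and "y' = [1, 2, 3, 4, 5, 6]\<^sup>\<omega>"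
    and "x12 = colour u y y'"
  shows "balanced x12 \<and> critical_exponent x12 = ereal (11 / 10)"
proof
  have x: "x12 = colour u ([1, 2, 3, 4, 5, 6]\<^sup>\<omega>) ([1, 2, 3, 4, 5, 6]\<^sup>\<omega>)"
    using assms(4-6) by simp
  interpret silver_word u
    by unfold_locales (rule La_count_bounds[OF assms(1-3)])+
  have "La_balanced u"
    using assms(1) sturmian_La_balanced by (simp add: standard_def)
  then show "balanced x12" using x by (rule colour_balanced)
  show "critical_exponent x12 = ereal (11 / 10)"
  proof (rule critical_exponent_eqI)
    show "x12 4 = x12 (4 + 10)"
      using repetition_at_distance_10[OF x] by simp
  qed (rule repetition_bound[OF x])
qed

end
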